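(* Let $c_0,c_h,\Delta t>0$ and consider, with periodic boundaries, the scheme $$\mathbf{B}_c^{n+1}=\mathbf{B}_c^n-\Delta t\,c_0\nabla_c^p\times\mathbf{E}_p^{n+\frac12}-\Delta t\,c_h\nabla_c^p\phi_p^{n+\frac12},\qquad \phi_p^{n+1}=\phi_p^n-\Delta t\,c_h\nabla_p^c\cdot\mathbf{B}_c^{n+\frac12},$$ $$\mathbf{E}_p^{n+1}=\mathbf{E}_p^n+\Delta t\,c_0\nabla_p^c\times\mathbf{B}_c^{n+\frac12}-\Delta t\,c_h\nabla_p^c\psi_c^{n+\frac12},\qquad \psi_c^{n+1}=\psi_c^n-\Delta t\,c_h\nabla_c^p\cdot\mathbf{E}_p^{n+\frac12},$$ where $X^{n+\frac12}=\frac12(X^n+X^{n+1})$ for each of the fields $X$. Then the scheme conserves the global discrete total energy $$\mathcal{E}^n=\sum_c|\Omega_c|\tfrac12|\mathbf{B}_c^n|^2+\sum_p|\Omega_p|\tfrac12(\phi_p^n)^2+\sum_p|\Omega_p|\tfrac12|\mathbf{E}_p^n|^2+\sum_c|\Omega_c|\tfrac12(\psi_c^n)^2$$ exactly, i.e. $\mathcal{E}^{n+1}=\mathcal{E}^n$.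
   Context: Staggered mesh with periodic boundaries: there are finitely many primary control volumes $\Omega_c$ (area $|\Omega_c|>0$, centers $\mathbf{x}_c$) and dual control volumes $\Omega_p$ (area $|\Omega_p|>0$) centered at the vertices $\mathbf{x}_p$ of the primary mesh. Write $p\in\Omega_c$ if $\mathbf{x}_p$ is a vertex of $\Omega_c$, and $c\in\Omega_p$ if $\mathbf{x}_c$ is a vertex of $\Omega_p$; $p\in\Omega_c$ iff $c\in\Omega_p$. To each such pair belongs a corner vector $l_{pc}\mathbf{n}_{pc}\in\mathbb{R}^3$, $\mathbf{n}_{cp}=-\mathbf{n}_{pc}$, with $\sum_{p\in\Omega_c}l_{pc}\mathbf{n}_{pc}=0$ for every $c$ and $\sum_{c\in\Omega_p}l_{pc}\mathbf{n}_{cp}=0$ for every $p$. On a uniform two-dimensional Cartesian mesh with spacings $\Delta x,\Delta y$, for $c=(i,j)$ and $p=(i+\frac{s}{2},j+\frac{s'}{2})$ with $s,s'\in\{\pm1\}$, one has $|\Omega_c|=|\Omega_p|=\Delta x\Delta y$ and $l_{pc}\mathbf{n}_{pc}=\frac12(s\Delta y,\,s'\Delta x,\,0)$. $\mathbf{B}_c^n\in\mathbb{R}^3$, $\psi_c^n\in\mathbb{R}$ live at the primary cells, $\mathbf{E}_p^n\in\mathbb{R}^3$, $\phi_p^n\in\mathbb{R}$ at the vertices. Discrete operators, where $\ast$ stands for multiplication by a scalar field (gradient), dot product (divergence) or cross product (curl): $\nabla_c^p\ast u_p=\frac1{|\Omega_c|}\sum_{p\in\Omega_c}l_{pc}\mathbf{n}_{pc}\ast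 u_p$ and $\nabla_p^c\ast u_c=\frac1{|\Omega_p|}\sum_{c\in\Omega_p}l_{pc}\mathbf{n}_{cp}\ast u_c$. *)

theory Defs
  imports "HOL-Analysis.Analysis"
begin

text \<open>
  Primary control volumes are labelled by \<open>'c\<close>, dual ones by \<open>'p\<close>. Points live in an arbitrary
  type \<open>'x\<close>, because the computational domain is a torus and not the plane. The field \<open>corner p c\<close>
  is the vector \<open>l\<^sub>p\<^sub>c n\<^sub>p\<^sub>c\<close>; it is only used for incident pairs.
\<close>

record ('c, 'p, 'x) mesh =
  cells :: "'c set"
  nodes :: "'p set"
  center :: "'c \<Rightarrow> 'x"
  pos :: "'p \<Rightarrow> 'x"
  cell_vertices :: "'c \<Rightarrow> 'x set"
  dual_vertices :: "'p \<Rightarrow> 'x set"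
  cell_area :: "'c \<Rightarrow> real"
  dual_area :: "'p \<Rightarrow> real"
  corner :: "'p \<Rightarrow> 'c \<Rightarrow> real^3"

definition nodes_of :: "('c, 'p, 'x) mesh \<Rightarrow> 'c \<Rightarrow> 'p set" where
  "nodes_of M c = {p \<in> nodes M. pos M p \<in> cell_vertices M c}"

definition cells_of :: "('c, 'p, 'x) mesh \<Rightarrow> 'p \<Rightarrow> 'c set" where
  "cells_of M p = {c \<in> cells M. center M c \<in> dual_vertices M p}"

text \<open>The vector \<open>l\<^sub>p\<^sub>c n\<^sub>c\<^sub>p\<close>, where \<open>n\<^sub>c\<^sub>p = - n\<^sub>p\<^sub>c\<close>.\<close>

definition dual_corner :: "('c, 'p, 'x) mesh \<Rightarrow> 'c \<Rightarrow> 'p \<Rightarrow> real^3" where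
  "dual_corner M c p = - corner M p c"

text \<open>
  Periodicity enters through the closure conditions, which hold for all primary and all dual
  control volumes: there are no boundary volumes. The dual vertices need not all be cell centers.
\<close>

locale staggered_mesh =
  fixes M :: "('c, 'p, 'x) mesh"
  assumes finite_cells: "finite (cells M)"
    and finite_nodes: "finite (nodes M)"
    and cell_area_pos: "c \<in> cells M \<Longrightarrow> cell_area M c > 0"
    and dual_area_pos: "p \<in> nodes M \<Longrightarrow> dual_area M p > 0"
    and nodes_are_vertices: "pos M ` nodes M = (\<Union>c\<in>cells M. cell_vertices M c)"
    and incidence: "c \<in> cells M \<Longrightarrow> p \<in> nodes M \<Longrightarrow> p \<in> nodes_of M c \<longleftrightarrow> c \<in> cells_of M p"
    and cell_closed: "c \<in> cells M \<Longrightarrow> (\<Sum>p\<in>nodes_of M c. corner M p c) = 0"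
    and dual_closed: "p \<in> nodes M \<Longrightarrow> (\<Sum>c\<in>cells_of M p. dual_corner M c p) = 0"

text \<open>
  The discrete operators \<open>\<nabla>\<^sub>c\<^sup>p \<ast> u\<close> (from nodes to cells) and \<open>\<nabla>\<^sub>p\<^sup>c \<ast> u\<close> (from cells to nodes); the first
  argument of the product \<open>\<ast>\<close> is the corner vector.
\<close>

definition nabla_cell ::
    "('c, 'p, 'x) mesh \<Rightarrow> (real^3 \<Rightarrow> 'u \<Rightarrow> 'v::real_vector) \<Rightarrow> ('p \<Rightarrow> 'u) \<Rightarrow> 'c \<Rightarrow> 'v" where
  "nabla_cell M star u c = (1 / cell_area M c) *\<^sub>R (\<Sum>p\<in>nodes_of M c. star (corner M p c) (u p))"

definition nabla_node ::
    "('c, 'p, 'x) mesh \<Rightarrow> (real^3 \<Rightarrow> 'u \<Rightarrow> 'v::real_vector) \<Rightarrow> ('c \<Rightarrow> 'u) \<Rightarrow> 'p \<Rightarrow> 'v" where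
  "nabla_node M star u p = (1 / dual_area M p) *\<^sub>R (\<Sum>c\<in>cells_of M p. star (dual_corner M c p) (u c))"

definition grad_cell :: "('c, 'p, 'x) mesh \<Rightarrow> ('p \<Rightarrow> real) \<Rightarrow> 'c \<Rightarrow> real^3" where
  "grad_cell M = nabla_cell M (\<lambda>n s. s *\<^sub>R n)"

definition div_cell :: "('c, 'p, 'x) mesh \<Rightarrow> ('p \<Rightarrow> real^3) \<Rightarrow> 'c \<Rightarrow> real" where
  "div_cell M = nabla_cell M (\<bullet>)"

definition curl_cell :: "('c, 'p, 'x) mesh \<Rightarrow> ('p \<Rightarrow> real^3) \<Rightarrow> 'c \<Rightarrow> real^3" where
  "curl_cell M = nabla_cell M cross3"

definition grad_node :: "('c, 'p, 'x) mesh \<Rightarrow> ('c \<Rightarrow> real) \<Rightarrow> 'p \<Rightarrow> real^3" where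
  "grad_node M = nabla_node M (\<lambda>n s. s *\<^sub>R n)"

definition div_node :: "('c, 'p, 'x) mesh \<Rightarrow> ('c \<Rightarrow> real^3) \<Rightarrow> 'p \<Rightarrow> real" where
  "div_node M = nabla_node M (\<bullet>)"

definition curl_node :: "('c, 'p, 'x) mesh \<Rightarrow> ('c \<Rightarrow> real^3) \<Rightarrow> 'p \<Rightarrow> real^3" where
  "curl_node M = nabla_node M cross3"

text \<open>The time average \<open>X\<^bsup>n+1/2\<^esup>\<close>.\<close>

definition half_step :: "(nat \<Rightarrow> 'i \<Rightarrow> 'v::real_vector) \<Rightarrow> nat \<Rightarrow> 'i \<Rightarrow> 'v" where
  "half_step X n i = (1/2) *\<^sub>R (X n i + X (Suc n) i)"

definition total_energy ::
    "('c, 'p, 'x) mesh \<Rightarrow> (nat \<Rightarrow> 'c \<Rightarrow> real^3) \<Rightarrow> (nat \<Rightarrow> 'p \<Rightarrow> real)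
      \<Rightarrow> (nat \<Rightarrow> 'p \<Rightarrow> real^3) \<Rightarrow> (nat \<Rightarrow> 'c \<Rightarrow> real) \<Rightarrow> nat \<Rightarrow> real" where
  "total_energy M B \<phi> E \<psi> n =
      (\<Sum>c\<in>cells M. cell_area M c * (1/2 * (norm (B n c))\<^sup>2))
    + (\<Sum>p\<in>nodes M. dual_area M p * (1/2 * (\<phi> n p)\<^sup>2))
    + (\<Sum>p\<in>nodes M. dual_area M p * (1/2 * (norm (E n p))\<^sup>2))
    + (\<Sum>c\<in>cells M. cell_area M c * (1/2 * (\<psi> n c)\<^sup>2))"

text \<open>
  The periodic uniform Cartesian mesh with \<open>Nx \<times> Ny\<close> cells. The node \<open>(i, j)\<close> is the point
  \<open>(i + 1/2, j + 1/2)\<close> in index coordinates, and points of the torus are represented by their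
  coordinates in one period. At least two cells per direction are needed, since otherwise the
  corners of a cell are not distinct.
\<close>

definition cartesian_mesh ::
    "int \<Rightarrow> int \<Rightarrow> real \<Rightarrow> real \<Rightarrow> (int \<times> int, int \<times> int, real \<times> real) mesh" where
  "cartesian_mesh Nx Ny dx dy =
    (let x = (\<lambda>(i, j). (of_int i * dx, of_int j * dy));
         xv = (\<lambda>(i, j). ((of_int i + 1/2) * dx, (of_int j + 1/2) * dy))
     in \<lparr> cells = {0..<Nx} \<times> {0..<Ny},
          nodes = {0..<Nx} \<times> {0..<Ny},
          center = x,
          pos = xv,
          cell_vertices = (\<lambda>(i, j). xv ` ({i, (i - 1) mod Nx} \<times> {j, (j - 1) mod Ny})),
          dual_vertices = (\<lambda>(i, j). x ` ({i, (i + 1) mod Nx} \<times> {j, (j + 1) mod Ny})),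
          cell_area = (\<lambda>_. dx * dy),
          dual_area = (\<lambda>_. dx * dy),
          corner = (\<lambda>(k, l) (i, j). (1/2) *\<^sub>R
            vector [(if k = i then 1 else -1) * dy, (if l = j then 1 else -1) * dx, 0]) \<rparr>)"

lemma mod_pred_succ:
  fixes i k N :: int
  assumes "i \<in> {0..<N}" "k \<in> {0..<N}"
  shows "k = (i - 1) mod N \<longleftrightarrow> i = (k + 1) mod N"
proof
  assume "k = (i - 1) mod N"
  then have "(k + 1) mod N = i mod N" by (simp add: mod_simps)
  then show "i = (k + 1) mod N" using assms by simp
next
  assume "i = (k + 1) mod N"
  then have "(i - 1) mod N = k mod N" by (simp add: mod_simps)
  then show "k = (i - 1) mod N" using assms by simp
qed

lemma mod_succ_neq:
  fixes i N :: int
  assumes "i \<in> {0..<N}" "N \<ge> 2"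
  shows "(i + 1) mod N \<noteq> i" "(i - 1) mod N \<noteq> i"
proof -
  have "\<not> N dvd 1" "\<not> N dvd -1" using assms by auto
  moreover have "i mod N = i" using assms by simp
  ultimately show "(i + 1) mod N \<noteq> i" "(i - 1) mod N \<noteq> i"
    using mod_eq_dvd_iff[of "i + 1" N i] mod_eq_dvd_iff[of "i - 1" N i] by auto
qed

lemma staggered_mesh_cartesian_mesh:
  assumes N: "Nx \<ge> 2" "Ny \<ge> 2" and d: "dx > 0" "dy > 0"
  shows "staggered_mesh (cartesian_mesh Nx Ny dx dy)"
proof -
  let ?M = "cartesian_mesh Nx Ny dx dy"
  let ?I = "{0..<Nx} \<times> {0..<Ny}"
  have I: "cells ?M = ?I" "nodes ?M = ?I"
    by (simp_all add: cartesian_mesh_def Let_def)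
  have nodes_of: "nodes_of ?M (i, j) = {i, (i - 1) mod Nx} \<times> {j, (j - 1) mod Ny}"
    if "(i, j) \<in> ?I" for i j
    using that N d by (auto simp: nodes_of_def cartesian_mesh_def Let_def)
  have cells_of: "cells_of ?M (i, j) = {i, (i + 1) mod Nx} \<times> {j, (j + 1) mod Ny}"
    if "(i, j) \<in> ?I" for i j
    using that N d by (auto simp: cells_of_def cartesian_mesh_def Let_def)
  show ?thesis
  proof
    show "pos ?M ` nodes ?M = (\<Union>c\<in>cells ?M. cell_vertices ?M c)"
      using N by (fastforce simp: cartesian_mesh_def Let_def)
    show "p \<in> nodes_of ?M c \<longleftrightarrow> c \<in> cells_of ?M p" if "c \<in> cells ?M" "p \<in> nodes ?M" for c p
    proof -
      obtain i j k l where cp: "c = (i, j)" "p = (k, l)" by (cases c, cases p)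
      show ?thesis
        using that mod_pred_succ[of i Nx k] mod_pred_succ[of j Ny l]
        by (auto simp: cp I nodes_of cells_of simp del: atLeastLessThan_iff)
    qed
    show "(\<Sum>p\<in>nodes_of ?M c. corner ?M p c) = 0" if "c \<in> cells ?M" for c
    proof -
      obtain i j where c: "c = (i, j)" by (cases c)
      show ?thesis
        using that N mod_succ_neq(2)[of i Nx] mod_succ_neq(2)[of j Ny]
        by (simp add: c I nodes_of flip: sum.cartesian_product)
          (simp add: cartesian_mesh_def vec_eq_iff forall_3)
    qed
    show "(\<Sum>c\<in>cells_of ?M p. dual_corner ?M c p) = 0" if "p \<in> nodes ?M" for p
    proof -
      obtain i j where p: "p = (i, j)" by (cases p)
      show ?thesis
        using that N mod_succ_neq(1)[of i Nx] mod_succ_neq(1)[of j Ny]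
        by (simp add: p I cells_of flip: sum.cartesian_product)
          (simp add: cartesian_mesh_def dual_corner_def vec_eq_iff forall_3)
    qed
  qed (use d in \<open>auto simp: cartesian_mesh_def Let_def\<close>)
qed

end

theory Submission
  imports Defs
begin

text \<open>
  The increment of \<open>1/2 |X|\<^sup>2\<close> over one time step is the inner product of the midpoint value
  \<open>X\<^bsup>n+1/2\<^esup>\<close> with the increment of \<open>X\<close>, exactly and not merely up to higher order in the step.
  Since the right-hand sides of the scheme are evaluated at the midpoint as well, the increment of
  the energy is a combination of pairings of midpoint fields with discrete curls, gradients and
  divergences of midpoint fields, and it remains to see that these pairings cancel.

  They cancel because the cell and the node operators are adjoint to each other up to sign
  (\<open>summation_by_parts\<close>): weighting an operator with the volume that it was divided by turns
  either side into a sum over the incident pairs of a cell and a node, and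
  \<open>n\<^sub>c\<^sub>p = - n\<^sub>p\<^sub>c\<close> relates the summands.
  The gradient and the divergence are thus negative adjoints, and the two halves of each such pair
  enter the scheme with the same sign and the same coefficient. The curl picks up a second sign from
  the antisymmetry of the triple product, so the two curls are adjoint to each other; as they enter
  the equations for \<open>B\<close> and \<open>E\<close> with opposite signs, they cancel too.
\<close>

context staggered_mesh
begin

text \<open>
  Incidence is a relation between cells and nodes, so the incident pairs may be enumerated from
  either side.
\<close>

lemma sum_incident_swap:
  fixes f :: "'c \<Rightarrow> 'p \<Rightarrow> 'v::comm_monoid_add"
  shows "(\<Sum>c\<in>cells M. \<Sum>p\<in>nodes_of M c. f c p) = (\<Sum>p\<in>nodes M. \<Sum>c\<in>cells_of M p. f c p)"
proof -
  have "(\<Sum>c\<in>cells M. \<Sum>p\<in>nodes_of M c. f c p)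
      = (\<Sum>c\<in>cells M. \<Sum>p | p \<in> nodes M \<and> p \<in> nodes_of M c. f c p)"
    by (intro sum.cong) (auto simp: nodes_of_def)
  also have "\<dots> = (\<Sum>p\<in>nodes M. \<Sum>c | c \<in> cells M \<and> p \<in> nodes_of M c. f c p)"
    by (rule sum.swap_restrict[OF finite_cells finite_nodes])
  also have "\<dots> = (\<Sum>p\<in>nodes M. \<Sum>c\<in>cells_of M p. f c p)"
  proof (intro sum.cong refl)
    fix p assume "p \<in> nodes M"
    then show "{c \<in> cells M. p \<in> nodes_of M c} = cells_of M p"
      using incidence by (auto simp: cells_of_def)
  qed
  finally show ?thesis .
qed

text \<open>
  The factor \<open>k\<close> is the sign in the duality between the two products: \<open>1\<close> for multiplication by a
  scalar against the dot product, \<open>-1\<close> for the cross product against itself. The minus sign in the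
  conclusion is the reversal of the corner vector between the two operators.
\<close>

lemma summation_by_parts:
  fixes star :: "real^3 \<Rightarrow> 'u::real_inner \<Rightarrow> 'v::real_inner" and star' :: "real^3 \<Rightarrow> 'v \<Rightarrow> 'u"
  assumes dual: "\<And>n u v. v \<bullet> star n u = k * (u \<bullet> star' n v)"
    and odd: "\<And>n v. star' (- n) v = - star' n v"
  shows "(\<Sum>c\<in>cells M. cell_area M c * (v c \<bullet> nabla_cell M star u c))
    = - k * (\<Sum>p\<in>nodes M. dual_area M p * (u p \<bullet> nabla_node M star' v p))"
proof -
  have cell: "cell_area M c * (v c \<bullet> nabla_cell M star u c)
      = (\<Sum>p\<in>nodes_of M c. k * (u p \<bullet> star' (corner M p c) (v c)))" if "c \<in> cells M" for c
    using cell_area_pos[OF that] by (simp add: nabla_cell_def inner_sum_right dual)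
  have node: "dual_area M p * (u p \<bullet> nabla_node M star' v p)
      = (\<Sum>c\<in>cells_of M p. - (u p \<bullet> star' (corner M p c) (v c)))" if "p \<in> nodes M" for p
    using dual_area_pos[OF that]
    by (simp add: nabla_node_def inner_sum_right dual_corner_def odd sum_negf)
  show ?thesis
    by (simp add: cell node sum_incident_swap sum_distrib_left sum_negf)
qed

lemma grad_cell_adjoint:
  "(\<Sum>c\<in>cells M. cell_area M c * (v c \<bullet> grad_cell M s c))
    = - (\<Sum>p\<in>nodes M. dual_area M p * (s p * div_node M v p))"
  using summation_by_parts[of "\<lambda>n s. s *\<^sub>R n" 1 "(\<bullet>)" v s]
  by (simp add: grad_cell_def div_node_def inner_commute)

lemma div_cell_adjoint:
  "(\<Sum>c\<in>cells M. cell_area M c * (s c * div_cell M v c))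
    = - (\<Sum>p\<in>nodes M. dual_area M p * (v p \<bullet> grad_node M s p))"
  using summation_by_parts[of "(\<bullet>)" 1 "\<lambda>n s. s *\<^sub>R n" s v]
  by (simp add: div_cell_def grad_node_def inner_commute)

lemma curl_cell_adjoint:
  "(\<Sum>c\<in>cells M. cell_area M c * (v c \<bullet> curl_cell M u c))
    = (\<Sum>p\<in>nodes M. dual_area M p * (u p \<bullet> curl_node M v p))"
proof -
  have dual: "v \<bullet> cross3 n u = - 1 * (u \<bullet> cross3 n v)" for n u v :: "real^3"
    by (simp add: cross3_def inner_vec_def sum_3 algebra_simps)
  have odd: "cross3 (- n) v = - cross3 n v" for n v
    by (simp add: cross3_def vec_eq_iff forall_3)
  show ?thesis
    using summation_by_parts[of cross3 "- 1" cross3 v u, OF dual odd]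
    by (simp add: curl_cell_def curl_node_def)
qed

end

text \<open>
  Polarisation, \<open>|y|\<^sup>2 - |x|\<^sup>2 = (x + y) \<bullet> (y - x)\<close>: for a quadratic energy the midpoint rule has no
  time discretisation error.
\<close>

lemma sum_quadratic_increment:
  fixes X :: "nat \<Rightarrow> 'i \<Rightarrow> 'v::real_inner"
  assumes "\<And>i. i \<in> I \<Longrightarrow> X (Suc n) i = X n i + D i"
  shows "(\<Sum>i\<in>I. w i * (1/2 * (norm (X (Suc n) i))\<^sup>2))
    = (\<Sum>i\<in>I. w i * (1/2 * (norm (X n i))\<^sup>2)) + (\<Sum>i\<in>I. w i * (half_step X n i \<bullet> D i))"
proof -
  have "w i * (1/2 * (norm (X (Suc n) i))\<^sup>2)
      = w i * (1/2 * (norm (X n i))\<^sup>2) + w i * (half_step X n i \<bullet> D i)" if "i \<in> I" for i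
    unfolding half_step_def assms[OF that] power2_norm_eq_inner
    by (simp add: inner_simps inner_commute algebra_simps)
  then show ?thesis
    unfolding sum.distrib[symmetric] by (rule sum.cong[OF refl])
qed

theorem theorem4p2:
  fixes M :: "('c, 'p, 'x) mesh"
    and c0 ch dt :: real
    and B :: "nat \<Rightarrow> 'c \<Rightarrow> real^3" and \<psi> :: "nat \<Rightarrow> 'c \<Rightarrow> real"
    and E :: "nat \<Rightarrow> 'p \<Rightarrow> real^3" and \<phi> :: "nat \<Rightarrow> 'p \<Rightarrow> real"
    and n :: nat
  assumes "staggered_mesh M"
    and "c0 > 0" and "ch > 0" and "dt > 0"
    and "\<And>c. c \<in> cells M \<Longrightarrow>
      B (Suc n) c = B n c - (dt * c0) *\<^sub>R curl_cell M (half_step E n) c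
                          - (dt * ch) *\<^sub>R grad_cell M (half_step \<phi> n) c"
    and "\<And>p. p \<in> nodes M \<Longrightarrow>
      \<phi> (Suc n) p = \<phi> n p - dt * ch * div_node M (half_step B n) p"
    and "\<And>p. p \<in> nodes M \<Longrightarrow>
      E (Suc n) p = E n p + (dt * c0) *\<^sub>R curl_node M (half_step B n) p
                          - (dt * ch) *\<^sub>R grad_node M (half_step \<psi> n) p"
    and "\<And>c. c \<in> cells M \<Longrightarrow>
      \<psi> (Suc n) c = \<psi> n c - dt * ch * div_cell M (half_step E n) c"
  shows "total_energy M B \<phi> E \<psi> (Suc n) = total_energy M B \<phi> E \<psi> n"
proof -
  interpret staggered_mesh M by fact
  let ?B = "half_step B n" and ?E = "half_step E n"
    and ?\<phi> = "half_step \<phi> n" and ?\<psi> = "half_step \<psi> n"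
  define curls where "curls = (\<Sum>p\<in>nodes M. dual_area M p * (?E p \<bullet> curl_node M ?B p))"
  define div_B where "div_B = (\<Sum>p\<in>nodes M. dual_area M p * (?\<phi> p * div_node M ?B p))"
  define grad_\<psi> where "grad_\<psi> = (\<Sum>p\<in>nodes M. dual_area M p * (?E p \<bullet> grad_node M ?\<psi> p))"

  have "(\<Sum>c\<in>cells M. cell_area M c * (1/2 * (norm (B (Suc n) c))\<^sup>2))
      = (\<Sum>c\<in>cells M. cell_area M c * (1/2 * (norm (B n c))\<^sup>2))
        + (\<Sum>c\<in>cells M. cell_area M c *
            (?B c \<bullet> (- (dt * c0) *\<^sub>R curl_cell M ?E c - (dt * ch) *\<^sub>R grad_cell M ?\<phi> c)))"
    by (rule sum_quadratic_increment) (simp add: assms(5))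
  also have "(\<Sum>c\<in>cells M. cell_area M c *
            (?B c \<bullet> (- (dt * c0) *\<^sub>R curl_cell M ?E c - (dt * ch) *\<^sub>R grad_cell M ?\<phi> c)))
      = - (dt * c0) * (\<Sum>c\<in>cells M. cell_area M c * (?B c \<bullet> curl_cell M ?E c))
        - (dt * ch) * (\<Sum>c\<in>cells M. cell_area M c * (?B c \<bullet> grad_cell M ?\<phi> c))"
    unfolding sum_distrib_left sum_subtractf[symmetric]
    by (simp add: inner_diff_right algebra_simps)
  also have "\<dots> = - (dt * c0) * curls + (dt * ch) * div_B"
    by (simp add: curl_cell_adjoint grad_cell_adjoint curls_def div_B_def)
  finally have B: "(\<Sum>c\<in>cells M. cell_area M c * (1/2 * (norm (B (Suc n) c))\<^sup>2))
      = (\<Sum>c\<in>cells M. cell_area M c * (1/2 * (norm (B n c))\<^sup>2))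
        + (- (dt * c0) * curls + (dt * ch) * div_B)" .

  have "(\<Sum>p\<in>nodes M. dual_area M p * (1/2 * (norm (E (Suc n) p))\<^sup>2))
      = (\<Sum>p\<in>nodes M. dual_area M p * (1/2 * (norm (E n p))\<^sup>2))
        + (\<Sum>p\<in>nodes M. dual_area M p *
            (?E p \<bullet> ((dt * c0) *\<^sub>R curl_node M ?B p - (dt * ch) *\<^sub>R grad_node M ?\<psi> p)))"
    by (rule sum_quadratic_increment) (simp add: assms(7))
  also have "(\<Sum>p\<in>nodes M. dual_area M p *
            (?E p \<bullet> ((dt * c0) *\<^sub>R curl_node M ?B p - (dt * ch) *\<^sub>R grad_node M ?\<psi> p)))
      = (dt * c0) * curls - (dt * ch) * grad_\<psi>"
    unfolding curls_def grad_\<psi>_def sum_distrib_left sum_subtractf[symmetric]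
    by (simp add: inner_diff_right algebra_simps)
  finally have E: "(\<Sum>p\<in>nodes M. dual_area M p * (1/2 * (norm (E (Suc n) p))\<^sup>2))
      = (\<Sum>p\<in>nodes M. dual_area M p * (1/2 * (norm (E n p))\<^sup>2))
        + ((dt * c0) * curls - (dt * ch) * grad_\<psi>)" .

  have "(\<Sum>p\<in>nodes M. dual_area M p * (1/2 * (norm (\<phi> (Suc n) p))\<^sup>2))
      = (\<Sum>p\<in>nodes M. dual_area M p * (1/2 * (norm (\<phi> n p))\<^sup>2))
        + (\<Sum>p\<in>nodes M. dual_area M p * (?\<phi> p \<bullet> (- (dt * ch) * div_node M ?B p)))"
    by (rule sum_quadratic_increment) (simp add: assms(6))
  also have "(\<Sum>p\<in>nodes M. dual_area M p * (?\<phi> p \<bullet> (- (dt * ch) * div_node M ?B p)))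
      = - (dt * ch) * div_B"
    unfolding div_B_def sum_distrib_left by (simp add: algebra_simps)
  finally have \<phi>: "(\<Sum>p\<in>nodes M. dual_area M p * (1/2 * (\<phi> (Suc n) p)\<^sup>2))
      = (\<Sum>p\<in>nodes M. dual_area M p * (1/2 * (\<phi> n p)\<^sup>2)) + - (dt * ch) * div_B"
    by simp

  have "(\<Sum>c\<in>cells M. cell_area M c * (1/2 * (norm (\<psi> (Suc n) c))\<^sup>2))
      = (\<Sum>c\<in>cells M. cell_area M c * (1/2 * (norm (\<psi> n c))\<^sup>2))
        + (\<Sum>c\<in>cells M. cell_area M c * (?\<psi> c \<bullet> (- (dt * ch) * div_cell M ?E c)))"
    by (rule sum_quadratic_increment) (simp add: assms(8))
  also have "(\<Sum>c\<in>cells M. cell_area M c * (?\<psi> c \<bullet> (- (dt * ch) * div_cell M ?E c)))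
      = - (dt * ch) * (\<Sum>c\<in>cells M. cell_area M c * (?\<psi> c * div_cell M ?E c))"
    unfolding sum_distrib_left by (simp add: algebra_simps)
  also have "\<dots> = (dt * ch) * grad_\<psi>"
    by (simp add: div_cell_adjoint grad_\<psi>_def)
  finally have \<psi>: "(\<Sum>c\<in>cells M. cell_area M c * (1/2 * (\<psi> (Suc n) c)\<^sup>2))
      = (\<Sum>c\<in>cells M. cell_area M c * (1/2 * (\<psi> n c)\<^sup>2)) + (dt * ch) * grad_\<psi>"
    by simp

  show ?thesis
    unfolding total_energy_def B E \<phi> \<psi> by simp
qed

end
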